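(* For any integers $k \ge 3$ and $l \ge 1$, $$\sigma^*(d(l, k)) = \bigcup_{j = 1}^{l+1} \{ x \colon W_{l, j}(x, k) = 0\}.$$ If $k = 2$ and $l \ge 1$, then $$\sigma^*(d(l, 2)) = \{ x \colon W_{l, l+1}(x, 2) = 0 \ \text{ or } \ W_{l, l}(x, 2) = 0\}.$$
   Context: For a finite simple graph $G$, $\sigma^*(G)$ denotes the set of all distinct eigenvalues of its adjacency matrix. For integers $l\ge 1$ and $k\ge 2$, the dendrimer $d(l,k)$ is the rooted tree with $l+1$ levels numbered $0,\dots,l$ (level $0$ consists of the root, level $l$ consists of the leaves) in which every vertex in levels $0,\dots,l-1$ (the internal vertices) has degree $k$; i.e. the root has $k$ children, every vertex in levels $1,\dots,l-1$ has $k-1$ children, and vertices in level $l$ have no children. The polynomials $W_{l,0}(x,k),\dots,W_{l,l+1}(x,k)$ in $x$ are defined by $W_{l,0}(x,k)=1$, $W_{l,1}(x,k)=x$, $W_{l,j}(x,k)=x\,W_{l,j-1}(x,k)-(k-1)\,W_{l,j-2}(x,k)$ for $2\le j\le l$, and $W_{l,l+1}(x,k)=x\,W_{l,l}(x,k)-k\,W_{l,l-1}(x,k)$. *)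

theory Defs
  imports "Graph_Theory.Pair_Digraph" "Jordan_Normal_Form.Spectral_Radius"
begin

text \<open>
  Finite simple graphs are symmetric, loop-free finite digraphs without parallel arcs
  (locale \<^locale>\<open>pair_graph\<close>): an undirected edge is represented by its two orientations.
\<close>

definition adjacency_matrix :: "'a pair_pre_digraph \<Rightarrow> 'a list \<Rightarrow> complex mat" where
  "adjacency_matrix G vs = mat (length vs) (length vs)
     (\<lambda>(i, j). if (vs ! i, vs ! j) \<in> parcs G then 1 else 0)"

text \<open>
  The enumeration of the vertices is chosen arbitrarily; \<open>distinct_eigenvalues_eq_spectrum\<close>
  below shows that the choice is immaterial.
\<close>

definition distinct_eigenvalues :: "'a pair_pre_digraph \<Rightarrow> complex set" (\<open>\<sigma>\<^sup>*\<close>) where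
  "\<sigma>\<^sup>* G = spectrum (adjacency_matrix G (SOME vs. distinct vs \<and> set vs = pverts G))"

lemma eigenvalue_adjacency_matrix_iff:
  assumes "distinct vs"
  shows "eigenvalue (adjacency_matrix G vs) x \<longleftrightarrow>
    (\<exists>f. (\<exists>v\<in>set vs. f v \<noteq> 0) \<and>
         (\<forall>v\<in>set vs. (\<Sum>w\<in>set vs. (if (v, w) \<in> parcs G then f w else 0)) = x * f v))"
    (is "?L \<longleftrightarrow> ?R")
proof -
  let ?n = "length vs" and ?A = "adjacency_matrix G vs"
  have bij: "bij_betw ((!) vs) {0..<?n} (set vs)"
    using bij_betw_nth[OF assms] by (simp add: atLeast0LessThan)
  have mult: "(?A *\<^sub>v u) $ i = (\<Sum>w\<in>set vs. (if (vs ! i, w) \<in> parcs G then f w else 0))"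
    if "dim_vec u = ?n" "i < ?n" "\<And>j. j < ?n \<Longrightarrow> f (vs ! j) = u $ j" for u f i
  proof -
    have "(?A *\<^sub>v u) $ i
        = (\<Sum>j\<in>{0..<?n}. if (vs ! i, vs ! j) \<in> parcs G then f (vs ! j) else 0)"
      using that by (auto simp: adjacency_matrix_def scalar_prod_def intro!: sum.cong)
    also have "\<dots> = (\<Sum>w\<in>set vs. (if (vs ! i, w) \<in> parcs G then f w else 0))"
      by (rule sum.reindex_bij_betw[OF bij])
    finally show ?thesis .
  qed
  have dim: "dim_row ?A = ?n" by (simp add: adjacency_matrix_def)
  show ?thesis
  proof
    assume ?L
    then obtain u where u: "u \<in> carrier_vec ?n" "u \<noteq> 0\<^sub>v ?n" "?A *\<^sub>v u = x \<cdot>\<^sub>v u"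
      by (auto simp: eigenvalue_def eigenvector_def dim)
    define f where "f = (\<lambda>v. u $ the_inv_into {0..<?n} ((!) vs) v)"
    have f: "f (vs ! j) = u $ j" if "j < ?n" for j
      using that bij by (simp add: f_def bij_betw_def the_inv_into_f_f)
    from u obtain i where i: "i < ?n" "u $ i \<noteq> 0"
      by (auto simp: vec_eq_iff)
    show ?R
    proof (intro exI conjI ballI)
      show "\<exists>v\<in>set vs. f v \<noteq> 0" using i f[of i] nth_mem[of i vs] by metis
    next
      fix v assume "v \<in> set vs"
      then obtain i where i: "i < ?n" "v = vs ! i" by (auto simp: in_set_conv_nth)
      have "(\<Sum>w\<in>set vs. (if (v, w) \<in> parcs G then f w else 0)) = (?A *\<^sub>v u) $ i"
        using mult[of u i f] u(1) i f by auto
      then show "(\<Sum>w\<in>set vs. (if (v, w) \<in> parcs G then f w else 0)) = x * f v"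
        using u i f by auto
    qed
  next
    assume ?R
    then obtain f v where v: "v \<in> set vs" "f v \<noteq> 0" and
      f: "\<And>v. v \<in> set vs \<Longrightarrow>
        (\<Sum>w\<in>set vs. (if (v, w) \<in> parcs G then f w else 0)) = x * f v" by auto
    define u where "u = vec ?n (\<lambda>i. f (vs ! i))"
    have "u \<noteq> 0\<^sub>v ?n" using v by (auto simp: u_def vec_eq_iff in_set_conv_nth)
    moreover have "?A *\<^sub>v u = x \<cdot>\<^sub>v u"
    proof (rule eq_vecI)
      fix i assume "i < dim_vec (x \<cdot>\<^sub>v u)"
      then have i: "i < ?n" by (simp add: u_def)
      show "(?A *\<^sub>v u) $ i = (x \<cdot>\<^sub>v u) $ i"
        using mult[of u i f] f[of "vs ! i"] i by (simp add: u_def)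
    qed (simp add: u_def adjacency_matrix_def)
    moreover have "u \<in> carrier_vec ?n" by (simp add: u_def)
    ultimately show ?L by (auto simp: eigenvalue_def eigenvector_def dim)
  qed
qed

lemma distinct_eigenvalues_eq_spectrum:
  assumes "distinct vs" "set vs = pverts G"
  shows "\<sigma>\<^sup>* G = spectrum (adjacency_matrix G vs)"
proof -
  define ws where "ws = (SOME vs. distinct vs \<and> set vs = pverts G)"
  have "distinct ws \<and> set ws = pverts G"
    unfolding ws_def by (rule someI[of _ vs]) (use assms in simp)
  then have "eigenvalue (adjacency_matrix G ws) x = eigenvalue (adjacency_matrix G vs) x" for x
    using assms by (simp add: eigenvalue_adjacency_matrix_iff)
  then show ?thesis
    by (auto simp: distinct_eigenvalues_def ws_def[symmetric] spectrum_def)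
qed

text \<open>
  A vertex on level \<open>m\<close> is the list of the \<open>m\<close> child indices chosen on the path from the
  root \<open>[]\<close>: the root has \<open>k\<close> children, every later internal vertex \<open>k - 1\<close>.
\<close>

definition dendrimer_verts :: "nat \<Rightarrow> nat \<Rightarrow> nat list set" where
  "dendrimer_verts l k =
     {p. length p \<le> l \<and> (\<forall>i<length p. p ! i < (if i = 0 then k else k - 1))}"

definition dendrimer :: "nat \<Rightarrow> nat \<Rightarrow> nat list pair_pre_digraph" where
  "dendrimer l k =
     \<lparr>pverts = dendrimer_verts l k,
      parcs = {(p, q). p \<in> dendrimer_verts l k \<and> q \<in> dendrimer_verts l k \<and>
                       (\<exists>c. q = p @ [c] \<or> p = q @ [c])}\<rparr>"

lemma finite_dendrimer_verts: "finite (dendrimer_verts l k)"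
proof (rule finite_subset)
  show "dendrimer_verts l k \<subseteq> {p. set p \<subseteq> {..<k} \<and> length p \<le> l}"
    by (fastforce simp: dendrimer_verts_def in_set_conv_nth split: if_splits)
qed (rule finite_lists_length_le, simp)

lemma pair_graph_dendrimer: "pair_graph (dendrimer l k)"
proof
  have "parcs (dendrimer l k) \<subseteq> dendrimer_verts l k \<times> dendrimer_verts l k"
    by (auto simp: dendrimer_def)
  then show "finite (parcs (dendrimer l k))"
    using finite_dendrimer_verts finite_subset by blast
qed (auto simp: dendrimer_def finite_dendrimer_verts symmetric_def intro!: symI)

lemma dendrimer_verts_snoc:
  "p @ [c] \<in> dendrimer_verts l k \<longleftrightarrow>
     p \<in> dendrimer_verts l k \<and> length p < l \<and> c < (if p = [] then k else k - 1)"
  by (auto simp: dendrimer_verts_def nth_append less_Suc_eq split: if_splits)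

lemma out_degree_dendrimer:
  assumes "l \<ge> 1" "k \<ge> 2" "p \<in> dendrimer_verts l k"
  shows "out_degree (dendrimer l k) p = (if length p < l then k else 1)"
proof -
  define C where "C = (if length p < l then {..<(if p = [] then k else k - 1)} else {})"
  define P where "P = (if p = [] then {} else {butlast p})"
  have "butlast p \<in> dendrimer_verts l k" if "p \<noteq> []"
    using that assms(3) dendrimer_verts_snoc[of "butlast p" "last p" l k] by simp
  then have "out_arcs (dendrimer l k) p = Pair p ` ((\<lambda>c. p @ [c]) ` C \<union> P)"
    using assms(3)
    by (auto simp: out_arcs_def dendrimer_def C_def P_def dendrimer_verts_snoc
          dendrimer_verts_snoc[of "[]", simplified] image_iff
        intro: append_butlast_last_id[symmetric] split: if_splits)
  moreover have "card ((\<lambda>c. p @ [c]) ` C \<union> P) = card C + card P"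
  proof (subst card_Un_disjoint)
    show "(\<lambda>c. p @ [c]) ` C \<inter> P = {}"
      by (auto simp: P_def dest!: arg_cong[where f = length])
  qed (auto simp: C_def P_def card_image inj_on_def)
  ultimately show ?thesis
    using assms by (auto simp: out_degree_def card_image inj_on_def C_def P_def)
qed

text \<open>
  The polynomial \<open>W\<^bsub>l,j\<^esub>(x, k)\<close>, meaningful for \<open>j \<le> l + 1\<close>; the coefficient changes from
  \<open>k - 1\<close> to \<open>k\<close> in the final step \<open>j = l + 1\<close>, which belongs to the root.
\<close>

fun W :: "nat \<Rightarrow> nat \<Rightarrow> nat \<Rightarrow> complex poly" where
  "W l k 0 = 1"
| "W l k (Suc 0) = [:0, 1:]"
| "W l k (Suc (Suc j)) =
     [:0, 1:] * W l k (Suc j) - Polynomial.smult (if Suc j = l then of_nat k else of_nat k - 1) (W l k j)"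

end

theory Submission
  imports Defs
begin

text \<open>
  Write \<open>w\<^bsub>j\<^esub>\<close> for \<open>W\<^bsub>l,j\<^esub>(x, k)\<close>. Eliminating the eigenvalue equations from the leaves
  towards the root shows that an eigenfunction satisfies \<open>w\<^bsub>h+1\<^esub> f(p) = w\<^bsub>h\<^esub> f(parent p)\<close> at
  every non-root vertex \<open>p\<close> of height \<open>h\<close>, and \<open>w\<^bsub>l+1\<^esub> f(root) = 0\<close>; so if no \<open>w\<^bsub>j\<^esub>\<close> with
  \<open>1 \<le> j \<le> l + 1\<close> vanishes, then \<open>f\<close> vanishes from the root downwards. For \<open>k = 2\<close> the
  vertices other than the root have at most one child, so \<open>f\<close> is determined by its values on
  levels \<open>0\<close> and \<open>1\<close> and only \<open>w\<^bsub>l+1\<^esub>\<close> and \<open>w\<^bsub>l\<^esub>\<close> matter. Conversely, let \<open>g(p) = w\<^bsub>h\<^esub>\<close> for \<open>p\<close> of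
  height \<open>h\<close>. If \<open>w\<^bsub>l+1\<^esub> = 0\<close>, then \<open>g\<close> is an eigenfunction; if \<open>w\<^bsub>j\<^esub> = 0\<close> for some \<open>j \<le> l\<close>, then
  one obtains an eigenfunction from \<open>g\<close> and \<open>-g\<close> on the subtrees of two children of a vertex
  of height \<open>j\<close>, extended by zero. That vertex has two children if \<open>j = l\<close> or \<open>k \<ge> 3\<close>.
\<close>

definition branching :: "nat \<Rightarrow> nat \<Rightarrow> nat list \<Rightarrow> nat" where
  "branching l k p = (if length p < l then if p = [] then k else k - 1 else 0)"

definition eigenfunction :: "nat \<Rightarrow> nat \<Rightarrow> complex \<Rightarrow> (nat list \<Rightarrow> complex) \<Rightarrow> bool" where
  "eigenfunction l k x f \<longleftrightarrow> (\<forall>p\<in>dendrimer_verts l k.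
     (if p = [] then 0 else f (butlast p)) + (\<Sum>c<branching l k p. f (p @ [c])) = x * f p)"

lemma child_in_dendrimer_verts:
  "p \<in> dendrimer_verts l k \<Longrightarrow> p @ [c] \<in> dendrimer_verts l k \<longleftrightarrow> c < branching l k p"
  by (auto simp: dendrimer_verts_snoc branching_def)

lemma butlast_in_dendrimer_verts:
  "p \<in> dendrimer_verts l k \<Longrightarrow> butlast p \<in> dendrimer_verts l k"
  using dendrimer_verts_snoc[of "butlast p" "last p" l k] by (cases "p = []") auto

lemma sum_neighbours_dendrimer:
  assumes "p \<in> dendrimer_verts l k"
  shows "(\<Sum>q\<in>dendrimer_verts l k. if (p, q) \<in> parcs (dendrimer l k) then f q else 0) =
    (if p = [] then 0 else f (butlast p)) + (\<Sum>c<branching l k p. f (p @ [c]))"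
    (is "?S = _")
proof -
  let ?C = "(\<lambda>c. p @ [c]) ` {..<branching l k p}" and ?P = "if p = [] then {} else {butlast p}"
  have "{q \<in> dendrimer_verts l k. (p, q) \<in> parcs (dendrimer l k)} = ?P \<union> ?C"
    using assms butlast_in_dendrimer_verts[OF assms]
    by (auto simp: dendrimer_def child_in_dendrimer_verts
          child_in_dendrimer_verts[of "[]", simplified]
        intro: append_butlast_last_id[symmetric])
  then have "?S = sum f (?P \<union> ?C)"
    by (simp add: sum.inter_filter[symmetric] finite_dendrimer_verts)
  also have "\<dots> = sum f ?P + sum f ?C"
    by (rule sum.union_disjoint) (auto dest!: arg_cong[where f = length])
  also have "sum f ?C = (\<Sum>c<branching l k p. f (p @ [c]))"
    by (subst sum.reindex) (auto simp: inj_on_def)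
  finally show ?thesis by simp
qed

lemma distinct_eigenvalues_dendrimer_iff:
  "x \<in> \<sigma>\<^sup>* (dendrimer l k) \<longleftrightarrow>
    (\<exists>f. eigenfunction l k x f \<and> (\<exists>p\<in>dendrimer_verts l k. f p \<noteq> 0))"
proof -
  obtain vs where vs: "distinct vs" "set vs = dendrimer_verts l k"
    using finite_distinct_list[OF finite_dendrimer_verts] by metis
  then have "\<sigma>\<^sup>* (dendrimer l k) = spectrum (adjacency_matrix (dendrimer l k) vs)"
    by (intro distinct_eigenvalues_eq_spectrum) (simp_all add: dendrimer_def)
  then have "x \<in> \<sigma>\<^sup>* (dendrimer l k) \<longleftrightarrow> eigenvalue (adjacency_matrix (dendrimer l k) vs) x"
    by (simp add: spectrum_def)
  then show ?thesis
    by (auto simp: eigenvalue_adjacency_matrix_iff[OF vs(1)] vs(2) eigenfunction_def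
        sum_neighbours_dendrimer)
qed

text \<open>The coefficient is written as the cast of a natural number so that it matches a sum over
  that many children.\<close>

lemma poly_W_rec:
  "k \<ge> 1 \<Longrightarrow> poly (W l k (Suc (Suc j))) x =
    x * poly (W l k (Suc j)) x - of_nat (if Suc j = l then k else k - 1) * poly (W l k j) x"
  by (simp add: of_nat_diff)

text \<open>Induction on the height: multiplying the equation at \<open>p\<close> by the coefficient
  of its children turns each child's value into a multiple of \<open>f p\<close>. Nothing is
  divided, so zeros of the polynomials do no harm.\<close>

lemma eigenfunction_parent:
  assumes f: "eigenfunction l k x f" and k: "k \<ge> 1"
    and p: "p \<in> dendrimer_verts l k" "p \<noteq> []" "length p + h = l"
  shows "poly (W l k (Suc h)) x * f p = poly (W l k h) x * f (butlast p)"
  using p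
proof (induction h arbitrary: p)
  case 0
  with f show ?case by (auto simp: eigenfunction_def branching_def)
next
  case (Suc h)
  define w where "w j = poly (W l k j) x" for j
  have b: "branching l k p = k - 1" and h: "Suc h \<noteq> l"
    using Suc.prems by (auto simp: branching_def)
  have child: "w (Suc h) * f (p @ [c]) = w h * f p" if "c < k - 1" for c
    using Suc.IH[of "p @ [c]"] Suc.prems that b child_in_dendrimer_verts[of p l k c]
    by (simp add: w_def)
  have "f (butlast p) + (\<Sum>c<k - 1. f (p @ [c])) = x * f p"
    using f Suc.prems b by (auto simp: eigenfunction_def)
  then have "w (Suc h) * (x * f p)
      = w (Suc h) * f (butlast p) + (\<Sum>c<k - 1. w (Suc h) * f (p @ [c]))"
    by (metis distrib_left sum_distrib_left)
  also have "(\<Sum>c<k - 1. w (Suc h) * f (p @ [c])) = of_nat (k - 1) * (w h * f p)"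
    by (simp add: child)
  finally have "(x * w (Suc h) - of_nat (k - 1) * w h) * f p = w (Suc h) * f (butlast p)"
    by (simp add: algebra_simps)
  then show ?case
    using poly_W_rec[OF k, of l h x] h by (simp add: w_def del: W.simps)
qed

lemma eigenfunction_root:
  assumes f: "eigenfunction l k x f" and k: "k \<ge> 1" and l: "l \<ge> 1"
  shows "poly (W l k (l + 1)) x * f [] = 0"
proof -
  define w where "w j = poly (W l k j) x" for j
  obtain h where h: "l = Suc h" using l by (cases l) auto
  have root: "[] \<in> dendrimer_verts l k" by (simp add: dendrimer_verts_def)
  have b: "branching l k [] = k" using l by (simp add: branching_def)
  have child: "w l * f [c] = w h * f []" if "c < k" for c
    using eigenfunction_parent[OF f k, of "[c]" h] child_in_dendrimer_verts[OF root, of c] b that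
    by (simp add: w_def h)
  have "(\<Sum>c<k. f [c]) = x * f []"
    using f root b by (auto simp: eigenfunction_def)
  then have "w l * (x * f []) = (\<Sum>c<k. w l * f [c])"
    by (metis sum_distrib_left)
  also have "\<dots> = of_nat k * (w h * f [])"
    by (simp add: child)
  finally have "(x * w l - of_nat k * w h) * f [] = 0"
    by (simp add: algebra_simps)
  then show ?thesis
    using poly_W_rec[OF k, of l h x] by (simp add: w_def h del: W.simps)
qed

lemma eigenfunction_eq_0:
  assumes f: "eigenfunction l k x f" and k: "k \<ge> 1" and l: "l \<ge> 1"
    and W: "\<And>j. j \<in> {1..l + 1} \<Longrightarrow> poly (W l k j) x \<noteq> 0"
    and p: "p \<in> dendrimer_verts l k"
  shows "f p = 0"
  using p
proof (induction p rule: rev_induct)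
  case Nil
  then show ?case using eigenfunction_root[OF f k l] W[of "l + 1"] by simp
next
  case (snoc c p)
  then have "p \<in> dendrimer_verts l k" "length p < l"
    by (auto simp: dendrimer_verts_snoc)
  then show ?case
    \<comment> \<open>This index lies in \<open>{1..l}\<close>, so the coefficient of
      \<open>f (p @ [c])\<close> can be cancelled.\<close>
    using snoc W[of "Suc (l - length (p @ [c]))"]
      eigenfunction_parent[OF f k snoc.prems, of "l - length (p @ [c])"]
    by simp
qed

lemma eigenfunction_path_eq_0:
  assumes f: "eigenfunction l 2 x f" and l: "l \<ge> 1"
    and W: "poly (W l 2 (l + 1)) x \<noteq> 0" "poly (W l 2 l) x \<noteq> 0"
    and p: "p \<in> dendrimer_verts l 2"
  shows "f p = 0"
  using p
\<comment> \<open>Below level 1 a value is determined by those at the parent and the grandparent,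
  hence induction on the length.\<close>
proof (induction p rule: length_induct)
  case (1 p)
  have root: "f [] = 0" using eigenfunction_root[OF f _ l] W by simp
  show ?case
  proof (cases p rule: rev_cases)
    case Nil
    then show ?thesis using root by simp
  next
    case (snoc q c)
    then have q: "q \<in> dendrimer_verts l 2" "length q < l"
      using "1.prems" by (auto simp: dendrimer_verts_snoc)
    show ?thesis
    proof (cases "q = []")
      case True
      then show ?thesis
        using eigenfunction_parent[OF f, of p "l - 1"] W root snoc "1.prems" l by simp
    next
      case False
      then have "c = 0" "branching l 2 q = 1"
        using q "1.prems" snoc by (auto simp: dendrimer_verts_snoc branching_def)
      moreover have "f q = 0" "f (butlast q) = 0"
        using "1.IH" q snoc butlast_in_dendrimer_verts[OF q(1)] by simp_all
      ultimately show ?thesis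
        using f q(1) False snoc by (auto simp: eigenfunction_def dest!: bspec[of _ _ q])
    qed
  qed
qed

text \<open>The radial function has defect \<open>w\<^bsub>l+1\<^esub>\<close> at the root and solves all other equations.\<close>

lemma radial_equation:
  assumes p: "p \<in> dendrimer_verts l k" and k: "k \<ge> 1" and l: "l \<ge> 1"
  shows "(if p = [] then poly (W l k (l + 1)) x else poly (W l k (l - length (butlast p))) x) +
      (\<Sum>c<branching l k p. poly (W l k (l - length (p @ [c]))) x)
    = x * poly (W l k (l - length p)) x"
proof (cases "length p = l")
  \<comment> \<open>A leaf has height 0 and its parent height 1, and \<open>W l k 1\<close> is
    \<open>x\<close> while \<open>W l k 0\<close> is 1.\<close>
  case True
  moreover from this l have "l - (length p - 1) = Suc 0" "p \<noteq> []" by auto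
  ultimately show ?thesis by (simp add: branching_def)
next
  case False
  with p have "length p < l" by (auto simp: dendrimer_verts_def)
  then obtain h where "l - length p = Suc h" by (cases "l - length p") auto
  then have h: "l = length p + Suc h" by simp
  \<comment> \<open>The root takes the last recursion step, with coefficient \<open>k\<close>; the
    other internal vertices take one with \<open>k - 1\<close>.\<close>
  show ?thesis
    using poly_W_rec[OF k, of l h x] h
    by (cases p rule: rev_cases) (auto simp: branching_def Suc_diff_le simp del: W.simps)
qed

lemma replicate_in_dendrimer_verts:
  "k \<ge> 2 \<Longrightarrow> n \<le> l \<Longrightarrow> replicate n 0 \<in> dendrimer_verts l k"
  by (auto simp: dendrimer_verts_def)

lemma root_W_imp_eigenvalue:
  assumes k: "k \<ge> 2" and l: "l \<ge> 1" and W: "poly (W l k (l + 1)) x = 0"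
  shows "x \<in> \<sigma>\<^sup>* (dendrimer l k)"
proof -
  let ?g = "\<lambda>p. poly (W l k (l - length p)) x"
  have "eigenfunction l k x ?g"
    unfolding eigenfunction_def
  proof
    fix p assume "p \<in> dendrimer_verts l k"
    then show "(if p = [] then 0 else ?g (butlast p)) + (\<Sum>c<branching l k p. ?g (p @ [c]))
        = x * ?g p"
      using radial_equation[of p l k x] k l W by auto
  qed
  moreover have "?g (replicate l 0) \<noteq> 0" by simp
  ultimately show ?thesis
    using replicate_in_dendrimer_verts[OF k order_refl]
    unfolding distinct_eigenvalues_dendrimer_iff by blast
qed

lemma branch_W_imp_eigenvalue:
  assumes k: "k \<ge> 2" and j: "1 \<le> j" "j \<le> l" and W: "poly (W l k j) x = 0"
    and jk: "j = l \<or> k \<ge> 3"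
  shows "x \<in> \<sigma>\<^sup>* (dendrimer l k)"
proof -
  define n where "n = l - j"
  define v where "v = replicate n (0::nat)"
  \<comment> \<open>The sign is 1 and -1 below children 0 and 1 of \<open>v\<close>; the entry
    \<open>p ! n\<close> tells through which child the path to \<open>p\<close> runs.\<close>
  define s :: "nat list \<Rightarrow> complex" where
    "s p = (if length p > n \<and> take n p = v
      then if p ! n = 0 then 1 else if p ! n = 1 then -1 else 0 else 0)" for p
  define g where "g p = poly (W l k (l - length p)) x" for p :: "nat list"
  have n: "n < l" "l - n = j" using j by (auto simp: n_def)
  have "eigenfunction l k x (\<lambda>p. s p * g p)"
    unfolding eigenfunction_def
  proof
    fix p assume p: "p \<in> dendrimer_verts l k"
    \<comment> \<open>Only on level \<open>Suc n\<close> can \<open>s\<close> differ from its value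
      at the parent; there the parent has height \<open>j\<close>, so \<open>g\<close> vanishes at
      it.\<close>
    have parent: "s (butlast p) * g (butlast p) = s p * g (butlast p)" if "p \<noteq> []"
    proof (cases "length p = Suc n")
      case True
      then show ?thesis using W n by (simp add: g_def)
    next
      case False
      then have "s (butlast p) = s p"
        by (auto simp: s_def nth_butlast take_butlast)
      then show ?thesis by simp
    qed
    have g_child: "g (p @ [c]) = g (p @ [0])" for c by (simp add: g_def)
    have children: "(\<Sum>c<branching l k p. s (p @ [c]) * g (p @ [c]))
        = s p * (\<Sum>c<branching l k p. g (p @ [c]))"
    proof (cases "length p > n")
      case True
      then have "s (p @ [c]) = s p" for c by (simp add: s_def nth_append)
      then show ?thesis by (simp add: sum_distrib_left)
    next
      case short: False
      \<comment> \<open>At \<open>v\<close> the signs 1 and -1 cancel; at any other vertex of level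
        at most \<open>n\<close> all children have sign 0.\<close>
      have "(\<Sum>c<branching l k p. s (p @ [c])) = 0"
      proof (cases "p = v")
        case True
        \<comment> \<open>If \<open>j = l\<close>, then \<open>v\<close> is the root and has
          \<open>k\<close> children; otherwise \<open>k - 1\<close> is at least 2.\<close>
        then have "branching l k p \<ge> 2"
          using k jk n by (auto simp: branching_def v_def n_def)
        then obtain b where "branching l k p = Suc (Suc b)"
          by (metis Suc_1 Suc_le_D add_2_eq_Suc le_Suc_ex)
        moreover have "s (p @ [c]) = (if c = 0 then 1 else if c = 1 then -1 else 0)" for c
          using True by (simp add: s_def v_def nth_append)
        ultimately show ?thesis by (simp add: sum.lessThan_Suc_shift del: sum.lessThan_Suc)
      next
        case False
        with short have "s (p @ [c]) = 0" for c by (auto simp: s_def)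
        then show ?thesis by simp
      qed
      moreover have "s p = 0" using short by (simp add: s_def)
      ultimately show ?thesis
        by (subst g_child) (simp add: sum_distrib_right[symmetric])
    qed
    have radial: "s p * ((if p = [] then poly (W l k (l + 1)) x else g (butlast p))
        + (\<Sum>c<branching l k p. g (p @ [c]))) = s p * (x * g p)"
      using radial_equation[OF p, of x] k j unfolding g_def by simp
    show "(if p = [] then 0 else s (butlast p) * g (butlast p))
        + (\<Sum>c<branching l k p. s (p @ [c]) * g (p @ [c])) = x * (s p * g p)"
    proof (cases "p = []")
      \<comment> \<open>The sign at the root is 0, so the defect of the radial function there does
        not matter.\<close>
      case True
      then show ?thesis unfolding children by (simp add: s_def)
    next
      case False
      then have "s p * g (butlast p) + s p * (\<Sum>c<branching l k p. g (p @ [c]))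
          = x * (s p * g p)"
        using radial unfolding distrib_left by (simp only: if_False mult.left_commute)
      then show ?thesis
        unfolding children using parent[OF False] False by (simp only: if_False)
    qed
  qed
  \<comment> \<open>This is a leaf below child 0 of \<open>v\<close>, where both factors are
    1.\<close>
  moreover have "s (replicate l 0) * g (replicate l 0) \<noteq> 0"
    using n by (simp add: s_def g_def v_def)
  ultimately show ?thesis
    using replicate_in_dendrimer_verts[OF k order_refl]
    unfolding distinct_eigenvalues_dendrimer_iff by blast
qed

theorem theorem8:
  fixes l :: nat
  assumes "l \<ge> 1"
  shows "(\<forall>k::nat. k \<ge> 3 \<longrightarrow>
            \<sigma>\<^sup>* (dendrimer l k) = (\<Union>j\<in>{1..l + 1}. {x::complex. poly (W l k j) x = 0})) \<and>
         \<sigma>\<^sup>* (dendrimer l 2) =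
            {x::complex. poly (W l 2 (l + 1)) x = 0 \<or> poly (W l 2 l) x = 0}"
proof (intro conjI allI impI equalityI subsetI)
  fix k :: nat and x assume k: "k \<ge> 3" and "x \<in> \<sigma>\<^sup>* (dendrimer l k)"
  then obtain f p where "eigenfunction l k x f" "p \<in> dendrimer_verts l k" "f p \<noteq> 0"
    by (auto simp: distinct_eigenvalues_dendrimer_iff)
  moreover have "k \<ge> 1" using k by simp
  ultimately show "x \<in> (\<Union>j\<in>{1..l + 1}. {x. poly (W l k j) x = 0})"
    using eigenfunction_eq_0[of l k x f p] assms by blast
next
  fix k :: nat and x
  assume k: "k \<ge> 3" and "x \<in> (\<Union>j\<in>{1..l + 1}. {x. poly (W l k j) x = 0})"
  then obtain j where j: "1 \<le> j" "j \<le> l + 1" "poly (W l k j) x = 0" by auto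
  show "x \<in> \<sigma>\<^sup>* (dendrimer l k)"
  proof (cases "j = l + 1")
    case True
    then show ?thesis using root_W_imp_eigenvalue[of k l x] j k assms by simp
  next
    case False
    then show ?thesis using branch_W_imp_eigenvalue[of k j l x] j k by simp
  qed
next
  fix x assume "x \<in> \<sigma>\<^sup>* (dendrimer l 2)"
  then obtain f p where "eigenfunction l 2 x f" "p \<in> dendrimer_verts l 2" "f p \<noteq> 0"
    by (auto simp: distinct_eigenvalues_dendrimer_iff)
  then show "x \<in> {x. poly (W l 2 (l + 1)) x = 0 \<or> poly (W l 2 l) x = 0}"
    using eigenfunction_path_eq_0[of l x f p] assms by blast
next
  fix x assume "x \<in> {x. poly (W l 2 (l + 1)) x = 0 \<or> poly (W l 2 l) x = 0}"
  then show "x \<in> \<sigma>\<^sup>* (dendrimer l 2)"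
    using root_W_imp_eigenvalue[of 2 l x] branch_W_imp_eigenvalue[of 2 l l x] assms by blast
qed

end
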